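(* Let $(M,\phi,\xi,\eta,g)$ be a $(2n+1)$-dimensional Kenmotsu manifold, let $a>0$ be a constant, and let $(\overline{\phi},\overline{\xi},\overline{\eta},\overline{g})$ be the $D$-homothetically deformed structure on $M$. Let $f\in C^\infty(M)$. If $(V=\overline{\mathrm{grad}}(f),\overline{\lambda})$ defines a gradient almost Ricci soliton in $(M,\overline{g})$, then $$|\overline{\mathrm{Ric}}|_{\overline{g}}^2\geq |\overline{\mathrm{Hess}}(f)|_{\overline{g}}^2-\frac{1}{2n+1}(\overline{\Delta}(f))^2.$$
   Context: An almost contact metric manifold $(M,\phi,\xi,\eta,g)$ is an odd-dimensional Riemannian manifold $(M,g)$, here of dimension $2n+1$ with $n\ge 1$, together with a $(1,1)$-tensor field $\phi$, a vector field $\xi$ (the Reeb vector field) and a $1$-form $\eta$ such that $\phi^2=-I+\eta\otimes\xi$, $\eta(\xi)=1$, $\eta=g(\xi,\cdot)$ and $g(\phi X,\phi Y)=g(X,Y)-\eta(X)\eta(Y)$. It is a Kenmotsu manifold if the Levi-Civita connection $\nabla$ of $g$ satisfies $(\nabla_X\phi)Y=g(\phi X,Y)\xi-\eta(Y)\phi X$ for all vector fields $X,Y$. For a constant $a>0$, the $D$-homothetically deformed structure is $\overline{\phi}=\phi$, $\overline{\xi}=\frac{1}{a}\xi$, $\overline{\eta}=a\eta$, $\overline{g}=ag+a(a-1)\eta\otimes\eta$. For a Riemannian metric $h$, a nowhere-vanishing vector field $V$ and a smooth function $\lambda$ on $M$, the pair $(V,\lambda)$ defines an almost Ricci soliton in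 $(M,h)$ if $\frac12\mathcal{L}_Vh+\mathrm{Ric}_h=\lambda h$, where $\mathcal{L}$ is the Lie derivative and $\mathrm{Ric}_h$ the Ricci tensor of $h$; it is called gradient if $V$ is the $h$-gradient of a smooth function. $\overline{\mathrm{grad}},\overline{\mathrm{Hess}},\overline{\Delta},\overline{\mathrm{Ric}}$ are the gradient, Hessian, Laplace operator (trace of the Hessian) and Ricci tensor of $\overline{g}$. $|T|_{\overline{g}}$ is the Hilbert–Schmidt norm: $|T|_{\overline{g}}^2=\sum_{i,j}T(e_i,e_j)^2$ for a $\overline{g}$-orthonormal frame $(e_i)$. The inequality is pointwise on $M$. *)

theory Defs
  imports "HOL-Analysis.Analysis" "HOL-Library.Function_Algebras"
begin

section \<open>Smooth manifolds\<close>

primrec C_k_on :: "nat \<Rightarrow> 'b::real_normed_vector set \<Rightarrow> ('b \<Rightarrow> 'c::real_normed_vector) \<Rightarrow> bool" where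
  "C_k_on 0 S f \<longleftrightarrow> continuous_on S f"
| "C_k_on (Suc k) S f \<longleftrightarrow> (\<forall>x\<in>S. f differentiable (at x)) \<and>
     (\<forall>v. C_k_on k S (\<lambda>x. frechet_derivative f (at x) v))"

text \<open>Only used for open \<open>S\<close>.\<close>

definition smooth_on :: "'b::real_normed_vector set \<Rightarrow> ('b \<Rightarrow> 'c::real_normed_vector) \<Rightarrow> bool" where
  "smooth_on S f \<longleftrightarrow> (\<forall>k. C_k_on k S f)"

text \<open>The manifold is a whole type \<open>'a\<close>, given by a (not necessarily maximal) smooth atlas of
  charts \<open>(U, c)\<close> with values in \<open>real ^ 'k\<close>; its dimension is \<open>CARD('k)\<close>.\<close>

type_synonym ('a, 'k) atlas = "('a set \<times> ('a \<Rightarrow> (real, 'k) vec)) set"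

definition smooth_manifold ::
    "('a::{t2_space, second_countable_topology}, 'k::finite) atlas \<Rightarrow> bool" where
  "smooth_manifold A \<longleftrightarrow>
     (\<forall>(U, c)\<in>A. open U \<and> open (c ` U) \<and> (\<exists>c'. homeomorphism U (c ` U) c c')) \<and>
     (\<Union>(U, c)\<in>A. U) = UNIV \<and>
     (\<forall>(U, c)\<in>A. \<forall>(W, d)\<in>A. smooth_on (c ` (U \<inter> W)) (d \<circ> inv_into U c))"

definition smooth_functions ::
    "('a::{t2_space, second_countable_topology}, 'k::finite) atlas \<Rightarrow> ('a \<Rightarrow> real) set" where
  "smooth_functions A = {f. \<forall>(U, c)\<in>A. smooth_on (c ` U) (f \<circ> inv_into U c)}"

text \<open>Tangent vectors at \<open>p\<close> are the derivations at \<open>p\<close> of the algebra of smooth functions,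
  represented by functionals that vanish on all functions that are not smooth.
  Addition, subtraction, zero and products of functions are the pointwise ones.\<close>

type_synonym 'a tvec = "('a \<Rightarrow> real) \<Rightarrow> real"

definition tscale :: "real \<Rightarrow> 'a tvec \<Rightarrow> 'a tvec" where
  "tscale r v = (\<lambda>f. r * v f)"

definition tangent_space ::
    "('a::{t2_space, second_countable_topology}, 'k::finite) atlas \<Rightarrow> 'a \<Rightarrow> 'a tvec set" where
  "tangent_space A p = {v.
     (\<forall>f. f \<notin> smooth_functions A \<longrightarrow> v f = 0) \<and>
     (\<forall>f\<in>smooth_functions A. \<forall>h\<in>smooth_functions A. v (f + h) = v f + v h) \<and>
     (\<forall>f\<in>smooth_functions A. \<forall>r. v (\<lambda>x. r * f x) = r * v f) \<and>
     (\<forall>f\<in>smooth_functions A. \<forall>h\<in>smooth_functions A. v (f * h) = f p * v h + h p * v f)}"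


section \<open>Vector fields and tensor fields\<close>

type_synonym 'a vfield = "'a \<Rightarrow> 'a tvec"

definition vf_apply :: "'a vfield \<Rightarrow> ('a \<Rightarrow> real) \<Rightarrow> 'a \<Rightarrow> real" where
  "vf_apply X f = (\<lambda>p. X p f)"

definition vf_scale :: "('a \<Rightarrow> real) \<Rightarrow> 'a vfield \<Rightarrow> 'a vfield" where
  "vf_scale u X = (\<lambda>p. tscale (u p) (X p))"

definition vector_fields ::
    "('a::{t2_space, second_countable_topology}, 'k::finite) atlas \<Rightarrow> 'a vfield set" where
  "vector_fields A = {X. (\<forall>p. X p \<in> tangent_space A p) \<and>
     (\<forall>f\<in>smooth_functions A. vf_apply X f \<in> smooth_functions A)}"

definition lie_bracket :: "'a vfield \<Rightarrow> 'a vfield \<Rightarrow> 'a vfield" where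
  "lie_bracket X Y = (\<lambda>p f. X p (vf_apply Y f) - Y p (vf_apply X f))"

definition one_form ::
    "('a::{t2_space, second_countable_topology}, 'k::finite) atlas \<Rightarrow> ('a \<Rightarrow> 'a tvec \<Rightarrow> real) \<Rightarrow> bool" where
  "one_form A \<eta> \<longleftrightarrow>
     (\<forall>p. \<forall>v\<in>tangent_space A p. \<forall>w\<in>tangent_space A p. \<eta> p (v + w) = \<eta> p v + \<eta> p w) \<and>
     (\<forall>p. \<forall>v\<in>tangent_space A p. \<forall>r. \<eta> p (tscale r v) = r * \<eta> p v) \<and>
     (\<forall>X\<in>vector_fields A. (\<lambda>p. \<eta> p (X p)) \<in> smooth_functions A)"

definition tensor_field_1_1 ::
    "('a::{t2_space, second_countable_topology}, 'k::finite) atlas \<Rightarrow> ('a \<Rightarrow> 'a tvec \<Rightarrow> 'a tvec) \<Rightarrow> bool" where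
  "tensor_field_1_1 A \<phi> \<longleftrightarrow>
     (\<forall>p. \<forall>v\<in>tangent_space A p. \<phi> p v \<in> tangent_space A p) \<and>
     (\<forall>p. \<forall>v\<in>tangent_space A p. \<forall>w\<in>tangent_space A p. \<phi> p (v + w) = \<phi> p v + \<phi> p w) \<and>
     (\<forall>p. \<forall>v\<in>tangent_space A p. \<forall>r. \<phi> p (tscale r v) = tscale r (\<phi> p v)) \<and>
     (\<forall>X\<in>vector_fields A. (\<lambda>p. \<phi> p (X p)) \<in> vector_fields A)"

type_synonym 'a metric = "'a \<Rightarrow> 'a tvec \<Rightarrow> 'a tvec \<Rightarrow> real"

definition riemannian_metric ::
    "('a::{t2_space, second_countable_topology}, 'k::finite) atlas \<Rightarrow> 'a metric \<Rightarrow> bool" where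
  "riemannian_metric A g \<longleftrightarrow>
     (\<forall>p. \<forall>u\<in>tangent_space A p. \<forall>v\<in>tangent_space A p. \<forall>w\<in>tangent_space A p.
        g p (u + v) w = g p u w + g p v w) \<and>
     (\<forall>p. \<forall>v\<in>tangent_space A p. \<forall>w\<in>tangent_space A p. \<forall>r. g p (tscale r v) w = r * g p v w) \<and>
     (\<forall>p. \<forall>v\<in>tangent_space A p. \<forall>w\<in>tangent_space A p. g p v w = g p w v) \<and>
     (\<forall>p. \<forall>v\<in>tangent_space A p. v \<noteq> 0 \<longrightarrow> g p v v > 0) \<and>
     (\<forall>X\<in>vector_fields A. \<forall>Y\<in>vector_fields A. (\<lambda>p. g p (X p) (Y p)) \<in> smooth_functions A)"


section \<open>Levi-Civita connection, curvature and Hessian\<close>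

text \<open>Connections are only meaningful on smooth vector fields; their values on other arguments are
  unconstrained and never used.\<close>

type_synonym 'a connection = "'a vfield \<Rightarrow> 'a vfield \<Rightarrow> 'a vfield"

definition affine_connection ::
    "('a::{t2_space, second_countable_topology}, 'k::finite) atlas \<Rightarrow> 'a connection \<Rightarrow> bool" where
  "affine_connection A D \<longleftrightarrow>
     (\<forall>X\<in>vector_fields A. \<forall>Y\<in>vector_fields A. D X Y \<in> vector_fields A) \<and>
     (\<forall>X\<in>vector_fields A. \<forall>Y\<in>vector_fields A. \<forall>Z\<in>vector_fields A.
        D (X + Y) Z = D X Z + D Y Z \<and> D X (Y + Z) = D X Y + D X Z) \<and>
     (\<forall>X\<in>vector_fields A. \<forall>Y\<in>vector_fields A. \<forall>u\<in>smooth_functions A.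
        D (vf_scale u X) Y = vf_scale u (D X Y) \<and>
        D X (vf_scale u Y) = vf_scale (vf_apply X u) Y + vf_scale u (D X Y))"

definition levi_civita ::
    "('a::{t2_space, second_countable_topology}, 'k::finite) atlas \<Rightarrow> 'a metric \<Rightarrow> 'a connection \<Rightarrow> bool" where
  "levi_civita A h D \<longleftrightarrow> affine_connection A D \<and>
     (\<forall>X\<in>vector_fields A. \<forall>Y\<in>vector_fields A. D X Y - D Y X = lie_bracket X Y) \<and>
     (\<forall>X\<in>vector_fields A. \<forall>Y\<in>vector_fields A. \<forall>Z\<in>vector_fields A. \<forall>p.
        X p (\<lambda>q. h q (Y q) (Z q)) = h p (D X Y p) (Z p) + h p (Y p) (D X Z p))"

definition curvature :: "'a connection \<Rightarrow> 'a vfield \<Rightarrow> 'a vfield \<Rightarrow> 'a vfield \<Rightarrow> 'a vfield" where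
  "curvature D X Y Z = D X (D Y Z) - D Y (D X Z) - D (lie_bracket X Y) Z"

text \<open>Covariant 2-tensor fields are given by their values on smooth vector fields. Orthonormal frames
  at \<open>p\<close> are the values at \<open>p\<close> of smooth vector fields; a family of \<open>CARD('k)\<close> orthonormal tangent
  vectors is automatically a basis. Trace and norm at \<open>p\<close> do not depend on the chosen frame.\<close>

type_synonym 'a tensor2 = "'a vfield \<Rightarrow> 'a vfield \<Rightarrow> 'a \<Rightarrow> real"

definition orthonormal_frame_at ::
    "('a::{t2_space, second_countable_topology}, 'k::finite) atlas \<Rightarrow> 'a metric \<Rightarrow> 'a \<Rightarrow> ('k \<Rightarrow> 'a vfield) \<Rightarrow> bool" where
  "orthonormal_frame_at A h p E \<longleftrightarrow> (\<forall>i. E i \<in> vector_fields A) \<and>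
     (\<forall>i j. h p (E i p) (E j p) = (if i = j then 1 else 0))"

definition orthonormal_frame ::
    "('a::{t2_space, second_countable_topology}, 'k::finite) atlas \<Rightarrow> 'a metric \<Rightarrow> 'a \<Rightarrow> 'k \<Rightarrow> 'a vfield" where
  "orthonormal_frame A h p = (SOME E. orthonormal_frame_at A h p E)"

definition metric_trace ::
    "('a::{t2_space, second_countable_topology}, 'k::finite) atlas \<Rightarrow> 'a metric \<Rightarrow> 'a tensor2 \<Rightarrow> 'a \<Rightarrow> real" where
  "metric_trace A h T p =
     (\<Sum>i\<in>UNIV. T (orthonormal_frame A h p i) (orthonormal_frame A h p i) p)"

definition hs_norm ::
    "('a::{t2_space, second_countable_topology}, 'k::finite) atlas \<Rightarrow> 'a metric \<Rightarrow> 'a tensor2 \<Rightarrow> 'a \<Rightarrow> real" where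
  "hs_norm A h T p =
     sqrt (\<Sum>i\<in>UNIV. \<Sum>j\<in>UNIV. (T (orthonormal_frame A h p i) (orthonormal_frame A h p j) p)\<^sup>2)"

text \<open>In \<open>ricci\<close>, \<open>hessian\<close> and \<open>laplacian\<close>, \<open>D\<close> is the Levi-Civita connection of \<open>h\<close>.
  Sign convention: \<open>Ric(X, Y)\<close> is the trace of \<open>Z \<mapsto> R(Z, X)Y\<close> (positive on round spheres).\<close>

definition ricci ::
    "('a::{t2_space, second_countable_topology}, 'k::finite) atlas \<Rightarrow> 'a metric \<Rightarrow> 'a connection \<Rightarrow> 'a tensor2" where
  "ricci A h D X Y = metric_trace A h (\<lambda>Z W p. h p (curvature D Z X Y p) (W p))"

definition hessian :: "'a connection \<Rightarrow> ('a \<Rightarrow> real) \<Rightarrow> 'a tensor2" where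
  "hessian D f X Y p = X p (vf_apply Y f) - D X Y p f"

definition laplacian ::
    "('a::{t2_space, second_countable_topology}, 'k::finite) atlas \<Rightarrow> 'a metric \<Rightarrow> 'a connection \<Rightarrow>
     ('a \<Rightarrow> real) \<Rightarrow> 'a \<Rightarrow> real" where
  "laplacian A h D f = metric_trace A h (hessian D f)"

definition is_gradient ::
    "('a::{t2_space, second_countable_topology}, 'k::finite) atlas \<Rightarrow> 'a metric \<Rightarrow> ('a \<Rightarrow> real) \<Rightarrow> 'a vfield \<Rightarrow> bool" where
  "is_gradient A h f V \<longleftrightarrow> V \<in> vector_fields A \<and>
     (\<forall>p. \<forall>w\<in>tangent_space A p. h p (V p) w = w f)"

definition lie_derivative :: "'a vfield \<Rightarrow> 'a metric \<Rightarrow> 'a tensor2" where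
  "lie_derivative V h X Y p = V p (\<lambda>q. h q (X q) (Y q))
     - h p (lie_bracket V X p) (Y p) - h p (X p) (lie_bracket V Y p)"

text \<open>\<open>D\<close> is the Levi-Civita connection of \<open>h\<close>.\<close>

definition almost_ricci_soliton ::
    "('a::{t2_space, second_countable_topology}, 'k::finite) atlas \<Rightarrow> 'a metric \<Rightarrow> 'a connection \<Rightarrow>
     'a vfield \<Rightarrow> ('a \<Rightarrow> real) \<Rightarrow> bool" where
  "almost_ricci_soliton A h D V l \<longleftrightarrow>
     V \<in> vector_fields A \<and> (\<forall>p. V p \<noteq> 0) \<and> l \<in> smooth_functions A \<and>
     (\<forall>X\<in>vector_fields A. \<forall>Y\<in>vector_fields A. \<forall>p.
        1 / 2 * lie_derivative V h X Y p + ricci A h D X Y p = l p * h p (X p) (Y p))"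


section \<open>Kenmotsu manifolds\<close>

definition almost_contact_metric ::
    "('a::{t2_space, second_countable_topology}, 'k::finite) atlas \<Rightarrow> ('a \<Rightarrow> 'a tvec \<Rightarrow> 'a tvec) \<Rightarrow>
     'a vfield \<Rightarrow> ('a \<Rightarrow> 'a tvec \<Rightarrow> real) \<Rightarrow> 'a metric \<Rightarrow> bool" where
  "almost_contact_metric A \<phi> \<xi> \<eta> g \<longleftrightarrow>
     smooth_manifold A \<and> odd CARD('k) \<and> riemannian_metric A g \<and>
     tensor_field_1_1 A \<phi> \<and> \<xi> \<in> vector_fields A \<and> one_form A \<eta> \<and>
     (\<forall>p. \<forall>v\<in>tangent_space A p. \<phi> p (\<phi> p v) = tscale (\<eta> p v) (\<xi> p) - v) \<and>
     (\<forall>p. \<eta> p (\<xi> p) = 1) \<and>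
     (\<forall>p. \<forall>v\<in>tangent_space A p. \<eta> p v = g p (\<xi> p) v) \<and>
     (\<forall>p. \<forall>v\<in>tangent_space A p. \<forall>w\<in>tangent_space A p.
        g p (\<phi> p v) (\<phi> p w) = g p v w - \<eta> p v * \<eta> p w)"

definition kenmotsu ::
    "('a::{t2_space, second_countable_topology}, 'k::finite) atlas \<Rightarrow> ('a \<Rightarrow> 'a tvec \<Rightarrow> 'a tvec) \<Rightarrow>
     'a vfield \<Rightarrow> ('a \<Rightarrow> 'a tvec \<Rightarrow> real) \<Rightarrow> 'a metric \<Rightarrow> bool" where
  "kenmotsu A \<phi> \<xi> \<eta> g \<longleftrightarrow> almost_contact_metric A \<phi> \<xi> \<eta> g \<and>
     (\<exists>D. levi_civita A g D \<and>
       (\<forall>X\<in>vector_fields A. \<forall>Y\<in>vector_fields A. \<forall>p.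
          D X (\<lambda>q. \<phi> q (Y q)) p - \<phi> p (D X Y p) =
          tscale (g p (\<phi> p (X p)) (Y p)) (\<xi> p) - tscale (\<eta> p (Y p)) (\<phi> p (X p))))"

definition D_homothetic_deformation ::
    "real \<Rightarrow> ('a \<Rightarrow> 'a tvec \<Rightarrow> 'a tvec) \<times> 'a vfield \<times> ('a \<Rightarrow> 'a tvec \<Rightarrow> real) \<times> 'a metric \<Rightarrow>
     ('a \<Rightarrow> 'a tvec \<Rightarrow> 'a tvec) \<times> 'a vfield \<times> ('a \<Rightarrow> 'a tvec \<Rightarrow> real) \<times> 'a metric" where
  "D_homothetic_deformation a = (\<lambda>(\<phi>, \<xi>, \<eta>, g).
     (\<phi>,
      \<lambda>p. tscale (1 / a) (\<xi> p),
      \<lambda>p v. a * \<eta> p v,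
      \<lambda>p v w. a * g p v w + a * (a - 1) * (\<eta> p v * \<eta> p w)))"

end

theory Submission
  imports Defs "HOL-Real_Asymp.Real_Asymp"
begin

text \<open>
  Write \<open>m = 2n + 1\<close> and let \<open>h\<close> be the deformed metric. For a gradient field the Lie derivative
  of the metric is twice the Hessian of the potential, so the soliton equation reads
  \<open>Hess f + Ric = \<lambda> h\<close>. In an \<open>h\<close>-orthonormal frame at a point this says that the matrix of
  \<open>Ric\<close> is \<open>\<lambda> I - H\<close>, where \<open>H\<close> is the matrix of the Hessian, and therefore
  \<open>|Ric|\<^sup>2 = |H|\<^sup>2 - 2 \<lambda> tr H + m \<lambda>\<^sup>2 = |H|\<^sup>2 - (tr H)\<^sup>2 / m + (m \<lambda> - tr H)\<^sup>2 / m\<close>.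
  Dropping the last term gives the inequality. This is
  \<open>gradient_almost_ricci_soliton_norm_ineq\<close>; the contact structure enters through
  \<open>deformed_metric_riemannian\<close>, since \<open>g(v, v) - \<eta>(v)\<^sup>2 = g(\<phi> v, \<phi> v) \<ge> 0\<close> makes the
  deformed metric positive definite for every \<open>a > 0\<close>.

  Traces and norms are computed in a frame picked by the choice operator, which says nothing unless
  an orthonormal frame of global smooth vector fields exists at each point
  (\<open>orthonormal_frame_at_exists\<close>). Tangent vectors are derivations of the algebra of global smooth
  functions, so such fields are built by hand: coordinate fields of a chart are cut off by a bump
  function and extended by zero. Their values at the point depend linearly and injectively on a
  direction in \<open>real ^ 'k\<close>, so the metric pulls back to an inner product there, and Gram--Schmidt
  applied to that inner product selects the directions of the frame.
\<close>

section \<open>Calculus of \<open>C\<^sup>k\<close> maps on open sets\<close>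

text \<open>Openness of \<open>S\<close> makes the derivative at a point of \<open>S\<close> insensitive to values outside \<open>S\<close>.\<close>

lemma C_k_on_cong:
  assumes "open S" "C_k_on k S f" "\<And>x. x \<in> S \<Longrightarrow> f x = g x"
  shows "C_k_on k S g"
  using assms(2,3)
proof (induction k arbitrary: f g)
  case 0
  then show ?case by (auto cong: continuous_on_cong)
next
  case (Suc k)
  have der: "(g has_derivative frechet_derivative f (at x)) (at x)" if "x \<in> S" for x
  proof -
    have "(f has_derivative frechet_derivative f (at x)) (at x)"
      using Suc.prems(1) that by (simp add: frechet_derivative_works[symmetric])
    then show ?thesis
      using has_derivative_transform_within_open[OF _ \<open>open S\<close> that] Suc.prems(2) by blast
  qed
  have "C_k_on k S (\<lambda>x. frechet_derivative g (at x) v)" for v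
  proof (rule Suc.IH)
    show "C_k_on k S (\<lambda>x. frechet_derivative f (at x) v)" using Suc.prems(1) by simp
    show "frechet_derivative f (at x) v = frechet_derivative g (at x) v" if "x \<in> S" for x
      using frechet_derivative_at[OF der[OF that]] by simp
  qed
  then show ?case using der by (auto simp: differentiable_def)
qed

text \<open>Any explicit formula for the derivative may replace the abstract one, which is how all the
  closure properties below are proved by induction on the order.\<close>

lemma C_k_on_Suc_intro:
  assumes "open S" "\<And>x. x \<in> S \<Longrightarrow> (f has_derivative f' x) (at x)"
    "\<And>v. C_k_on k S (\<lambda>x. f' x v)"
  shows "C_k_on (Suc k) S f"
proof -
  have "C_k_on k S (\<lambda>x. frechet_derivative f (at x) v)" for v
    by (rule C_k_on_cong[OF assms(1) assms(3)[of v]])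
      (use frechet_derivative_at[OF assms(2)] in simp)
  then show ?thesis using assms(2) by (auto simp: differentiable_def)
qed

lemma C_k_on_Suc_has_derivative:
  "C_k_on (Suc k) S f \<Longrightarrow> x \<in> S \<Longrightarrow> (f has_derivative frechet_derivative f (at x)) (at x)"
  by (simp add: frechet_derivative_works[symmetric])

lemma C_k_on_Suc_imp: "C_k_on (Suc k) S f \<Longrightarrow> C_k_on k S f"
proof (induction k arbitrary: f)
  case 0
  then have "\<forall>x\<in>S. f differentiable at x" by simp
  then show ?case
    by (simp add: continuous_at_imp_continuous_on differentiable_imp_continuous_within)
next
  case (Suc k)
  have "\<forall>x\<in>S. f differentiable at x" "\<forall>v. C_k_on (Suc k) S (\<lambda>x. frechet_derivative f (at x) v)"
    using Suc.prems C_k_on.simps(2)[of "Suc k" S f] by blast+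
  then show ?case unfolding C_k_on.simps(2)[of k S f] using Suc.IH by blast
qed

lemma C_k_on_Un:
  assumes "open S" "open T"
  shows "C_k_on k S f \<Longrightarrow> C_k_on k T f \<Longrightarrow> C_k_on k (S \<union> T) f"
proof (induction k arbitrary: f)
  case 0
  then show ?case using assms by (simp add: continuous_on_open_Un)
next
  case (Suc k)
  then show ?case by (simp only: C_k_on.simps) blast
qed

lemma C_k_on_const: "C_k_on k S (\<lambda>x. c)"
  by (induction k arbitrary: c) simp_all

lemma C_k_on_ident: "open S \<Longrightarrow> C_k_on k S (\<lambda>x. x)"
proof (induction k)
  case (Suc k)
  then show ?case
    by (intro C_k_on_Suc_intro[where f' = "\<lambda>_ v. v"] has_derivative_ident C_k_on_const)
qed simp

lemma C_k_on_add:
  assumes "open S"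
  shows "C_k_on k S f \<Longrightarrow> C_k_on k S g \<Longrightarrow> C_k_on k S (\<lambda>x. f x + g x)"
proof (induction k arbitrary: f g)
  case (Suc k)
  show ?case
    by (rule C_k_on_Suc_intro[OF assms has_derivative_add[OF C_k_on_Suc_has_derivative[OF Suc.prems(1)]
            C_k_on_Suc_has_derivative[OF Suc.prems(2)]]])
      (use Suc in simp_all)
qed (simp add: continuous_on_add)

lemma (in bounded_bilinear) C_k_on:
  assumes "open S"
  shows "C_k_on k S f \<Longrightarrow> C_k_on k S g \<Longrightarrow> C_k_on k S (\<lambda>x. prod (f x) (g x))"
proof (induction k arbitrary: f g)
  case (Suc k)
  let ?f' = "\<lambda>x. frechet_derivative f (at x)" and ?g' = "\<lambda>x. frechet_derivative g (at x)"
  show ?case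
  proof (rule C_k_on_Suc_intro[OF assms])
    show "((\<lambda>x. prod (f x) (g x)) has_derivative (\<lambda>v. prod (f x) (?g' x v) + prod (?f' x v) (g x))) (at x)"
      if "x \<in> S" for x
      by (rule FDERIV[OF C_k_on_Suc_has_derivative[OF Suc.prems(1) that]
            C_k_on_Suc_has_derivative[OF Suc.prems(2) that]])
    show "C_k_on k S (\<lambda>x. prod (f x) (?g' x v) + prod (?f' x v) (g x))" for v
    proof (rule C_k_on_add[OF assms])
      show "C_k_on k S (\<lambda>x. prod (f x) (?g' x v))"
        by (rule Suc.IH[OF C_k_on_Suc_imp[OF Suc.prems(1)]]) (use Suc.prems(2) in simp)
      show "C_k_on k S (\<lambda>x. prod (?f' x v) (g x))"
        by (rule Suc.IH[OF _ C_k_on_Suc_imp[OF Suc.prems(2)]]) (use Suc.prems(1) in simp)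
    qed
  qed
qed (unfold C_k_on.simps, rule continuous_on)

lemma C_k_on_sum:
  "open S \<Longrightarrow> (\<And>i. i \<in> I \<Longrightarrow> C_k_on k S (f i)) \<Longrightarrow> C_k_on k S (\<lambda>x. \<Sum>i\<in>I. f i x)"
  by (induction I rule: infinite_finite_induct) (auto simp: C_k_on_const C_k_on_add)

text \<open>The directional derivative of the composite, expanded in a basis of the intermediate space, is
  a sum of products of a component of \<open>g'\<close> with a composite of \<open>g\<close> and a partial derivative of \<open>f\<close>,
  and the induction hypothesis applies to the partial derivatives of \<open>f\<close>.\<close>

lemma C_k_on_compose:
  fixes f :: "'b::euclidean_space \<Rightarrow> 'c::real_normed_vector"
  assumes "open S"
  shows "C_k_on k S g \<Longrightarrow> C_k_on k T f \<Longrightarrow> g ` S \<subseteq> T \<Longrightarrow> C_k_on k S (\<lambda>x. f (g x))"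
proof (induction k arbitrary: f)
  case 0
  then show ?case using continuous_on_compose2[of T f S g] by simp
next
  case (Suc k)
  let ?f' = "\<lambda>y. frechet_derivative f (at y)" and ?g' = "\<lambda>x. frechet_derivative g (at x)"
  have der: "((\<lambda>x. f (g x)) has_derivative
      (\<lambda>v. \<Sum>b\<in>Basis. (?g' x v \<bullet> b) *\<^sub>R ?f' (g x) b)) (at x)" if "x \<in> S" for x
  proof -
    have f': "(f has_derivative ?f' (g x)) (at (g x))"
      using Suc.prems that by (intro C_k_on_Suc_has_derivative) auto
    have expand: "?f' (g x) w = (\<Sum>b\<in>Basis. (w \<bullet> b) *\<^sub>R ?f' (g x) b)" for w
    proof -
      interpret linear "?f' (g x)" by (rule has_derivative_linear[OF f'])
      have "?f' (g x) (\<Sum>b\<in>Basis. (w \<bullet> b) *\<^sub>R b) = (\<Sum>b\<in>Basis. (w \<bullet> b) *\<^sub>R ?f' (g x) b)"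
        by (simp only: sum scaleR)
      then show ?thesis by (simp add: euclidean_representation)
    qed
    show ?thesis
      using has_derivative_compose[OF C_k_on_Suc_has_derivative[OF Suc.prems(1) that] f']
      by (subst expand[symmetric])
  qed
  have "C_k_on k S (\<lambda>x. \<Sum>b\<in>Basis. (?g' x v \<bullet> b) *\<^sub>R ?f' (g x) b)" for v
  proof (intro C_k_on_sum[OF assms] bounded_bilinear.C_k_on[OF bounded_bilinear_scaleR assms]
        bounded_bilinear.C_k_on[OF bounded_bilinear_inner assms] C_k_on_const)
    show "C_k_on k S (\<lambda>x. ?g' x v)" using Suc.prems(1) by simp
    show "C_k_on k S (\<lambda>x. ?f' (g x) b)" for b
      using Suc.IH[of "\<lambda>y. ?f' y b"] C_k_on_Suc_imp[OF Suc.prems(1)] Suc.prems(2,3) by simp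
  qed
  then show ?case by (intro C_k_on_Suc_intro[OF assms der])
qed

lemmas C_k_on_mult = bounded_bilinear.C_k_on[OF bounded_bilinear_mult]
lemmas C_k_on_inner = bounded_bilinear.C_k_on[OF bounded_bilinear_inner]

section \<open>Bump functions\<close>

text \<open>The classical flat function \<open>exp (-1/t)\<close> together with its multiples by powers of \<open>1/t\<close>: the
  derivative of each member is a combination of later members, so all of them are smooth at once.\<close>

definition flat_exp :: "nat \<Rightarrow> real \<Rightarrow> real" where
  "flat_exp m t = (if t > 0 then exp (- inverse t) * inverse t ^ m else 0)"

lemma flat_exp_tendsto_0: "(flat_exp m \<longlongrightarrow> 0) (at 0)"
proof -
  have "((\<lambda>t::real. exp (- inverse t) * inverse t ^ m) \<longlongrightarrow> 0) (at_right 0)"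
    by real_asymp
  then have "(flat_exp m \<longlongrightarrow> 0) (at_right 0)"
    by (rule Lim_transform_eventually) (auto simp: flat_exp_def eventually_at_right_less
        intro: eventually_mono[OF eventually_at_right_less])
  moreover have "(flat_exp m \<longlongrightarrow> 0) (at_left 0)"
    by (rule tendsto_eventually) (auto simp: flat_exp_def eventually_at_filter)
  ultimately show ?thesis by (simp add: filterlim_split_at)
qed

lemma flat_exp_has_real_derivative:
  "(flat_exp m has_real_derivative (flat_exp (m + 2) t - m * flat_exp (m + 1) t)) (at t)"
proof -
  consider "t > 0" | "t < 0" | "t = 0" by linarith
  then show ?thesis
  proof cases
    case 1
    have "((\<lambda>t. exp (- inverse t) * inverse t ^ m) has_real_derivative
        exp (- inverse t) * (inverse t * inverse t) * inverse t ^ m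
        - exp (- inverse t) * (m * inverse t ^ (m - 1) * (inverse t * inverse t))) (at t)"
      using 1 by (auto intro!: derivative_eq_intros)
    moreover have "exp (- inverse t) * (inverse t * inverse t) * inverse t ^ m
        - exp (- inverse t) * (m * inverse t ^ (m - 1) * (inverse t * inverse t))
        = flat_exp (m + 2) t - m * flat_exp (m + 1) t"
      using 1 by (cases m) (simp_all add: flat_exp_def algebra_simps)
    ultimately have "((\<lambda>t. exp (- inverse t) * inverse t ^ m) has_real_derivative
        (flat_exp (m + 2) t - m * flat_exp (m + 1) t)) (at t)"
      by (simp only:)
    then show ?thesis
      by (rule has_field_derivative_transform_within_open[where S = "{0<..}"])
        (use 1 in \<open>auto simp: flat_exp_def\<close>)
  next
    case 2
    have "((\<lambda>t. 0) has_real_derivative (flat_exp (m + 2) t - m * flat_exp (m + 1) t)) (at t)"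
      using 2 by (simp add: flat_exp_def)
    then show ?thesis
      by (rule has_field_derivative_transform_within_open[where S = "{..<0}"])
        (use 2 in \<open>auto simp: flat_exp_def\<close>)
  next
    case 3
    \<comment> \<open>At the origin the difference quotient is the next member of the family.\<close>
    have eq: "(\<lambda>h. (flat_exp m (0 + h) - flat_exp m 0) / h) = flat_exp (Suc m)"
      by (auto simp: flat_exp_def divide_inverse)
    have "(\<lambda>h. (flat_exp m (0 + h) - flat_exp m 0) / h) \<midarrow>0\<rightarrow> 0"
      unfolding eq by (rule flat_exp_tendsto_0)
    then show ?thesis unfolding 3 DERIV_def by (simp add: flat_exp_def)
  qed
qed

lemma C_k_on_flat_exp: "C_k_on k UNIV (flat_exp m)"
proof (induction k arbitrary: m)
  case 0
  then show ?case
    using flat_exp_has_real_derivative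
    by (auto intro!: continuous_at_imp_continuous_on DERIV_isCont)
next
  case (Suc k)
  have "C_k_on k UNIV (\<lambda>t. (flat_exp (m + 2) t + (- real m) * flat_exp (m + 1) t) * v)" for v
    by (intro C_k_on_mult C_k_on_add C_k_on_const Suc open_UNIV)
  then show ?case
    by (intro C_k_on_Suc_intro[OF open_UNIV
          flat_exp_has_real_derivative[unfolded has_field_derivative_def]]) simp
qed

lemma bump_function_exists:
  fixes x0 :: "'b::euclidean_space"
  assumes "open S" "x0 \<in> S"
  obtains \<psi> K where "\<And>k T. open T \<Longrightarrow> C_k_on k T \<psi>" "(\<psi> x0 :: real) > 0"
    "compact K" "K \<subseteq> S" "\<And>x. x \<notin> K \<Longrightarrow> \<psi> x = 0"
proof -
  obtain r where r: "r > 0" "cball x0 r \<subseteq> S" using assms open_contains_cball by blast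
  \<comment> \<open>\<open>exp (-1/(r\<^sup>2 - |x - x0|\<^sup>2))\<close> inside the ball, written with the operations of the calculus above\<close>
  let ?\<psi> = "\<lambda>x. flat_exp 0 (r\<^sup>2 + (- 1) * ((x + - x0) \<bullet> (x + - x0)))"
  show thesis
  proof (rule that[of ?\<psi> "cball x0 r"])
    show "C_k_on k T ?\<psi>" if "open T" for k T
      by (rule C_k_on_compose[OF that _ C_k_on_flat_exp])
        (intro C_k_on_add C_k_on_mult C_k_on_inner C_k_on_const C_k_on_ident that, simp)
    show "?\<psi> x = 0" if "x \<notin> cball x0 r" for x
    proof -
      have "r < norm (x - x0)" using that by (simp add: dist_norm norm_minus_commute)
      then have "r\<^sup>2 < (norm (x - x0))\<^sup>2" using r by (intro power_strict_mono) auto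
      then show ?thesis by (simp add: flat_exp_def dot_square_norm)
    qed
  qed (use r in \<open>auto simp: flat_exp_def\<close>)
qed

section \<open>Smooth functions and fields supported in a chart\<close>

lemma smooth_functionsD:
  "f \<in> smooth_functions A \<Longrightarrow> (U, c) \<in> A \<Longrightarrow> C_k_on k (c ` U) (f \<circ> inv_into U c)"
  by (auto simp: smooth_functions_def smooth_on_def)

lemma chartD:
  assumes "smooth_manifold A" "(U, c) \<in> A"
  shows "open U" "open (c ` U)" "inj_on c U" "\<And>W. open W \<Longrightarrow> open (c ` (U \<inter> W))"
    "continuous_on (c ` U) (inv_into U c)"
proof -
  obtain c' where c': "open U" "open (c ` U)" "homeomorphism U (c ` U) c c'"
    using assms by (auto simp: smooth_manifold_def)
  then show "open U" "open (c ` U)" by auto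
  show inj: "inj_on c U" using c'(3) by (metis homeomorphism_def inj_on_inverseI)
  have "inv_into U c y = c' y" if "y \<in> c ` U" for y
    using that c'(3) inj by (auto simp: homeomorphism_def)
  then show "continuous_on (c ` U) (inv_into U c)"
    using c'(3) by (simp add: homeomorphism_def cong: continuous_on_cong)
  show "open (c ` (U \<inter> W))" if "open W" for W
  proof -
    have "openin (top_of_set U) (U \<inter> W)" using that by auto
    then have "openin (top_of_set (c ` U)) (c ` (U \<inter> W))"
      using homeomorphism_imp_open_map[OF c'(3)] by blast
    then show ?thesis using c'(2) openin_open_trans by blast
  qed
qed

lemma smooth_functions_add:
  assumes "smooth_manifold A" "f \<in> smooth_functions A" "h \<in> smooth_functions A"
  shows "f + h \<in> smooth_functions A"
  unfolding smooth_functions_def smooth_on_def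
proof clarify
  fix U c k assume "(U, c) \<in> A"
  from C_k_on_add[OF chartD(2)[OF assms(1) this] smooth_functionsD[OF assms(2) this]
      smooth_functionsD[OF assms(3) this]]
  show "C_k_on k (c ` U) ((f + h) \<circ> inv_into U c)" by (simp add: o_def plus_fun_def)
qed

lemma smooth_functions_mult:
  assumes "smooth_manifold A" "f \<in> smooth_functions A" "h \<in> smooth_functions A"
  shows "f * h \<in> smooth_functions A"
  unfolding smooth_functions_def smooth_on_def
proof clarify
  fix U c k assume "(U, c) \<in> A"
  from C_k_on_mult[OF chartD(2)[OF assms(1) this] smooth_functionsD[OF assms(2) this]
      smooth_functionsD[OF assms(3) this]]
  show "C_k_on k (c ` U) ((f * h) \<circ> inv_into U c)" by (simp add: o_def times_fun_def)
qed

lemma smooth_functions_const: "(\<lambda>x. r) \<in> smooth_functions A"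
  by (auto simp: smooth_functions_def smooth_on_def o_def C_k_on_const)

lemma smooth_functions_scale:
  assumes "smooth_manifold A" "f \<in> smooth_functions A"
  shows "(\<lambda>x. r * f x) \<in> smooth_functions A"
  using smooth_functions_mult[OF assms(1) smooth_functions_const assms(2)] by (simp add: times_fun_def)

text \<open>The preimage \<open>L\<close> of \<open>K\<close> in \<open>U\<close> is compact, hence closed because the manifold is Hausdorff. So
  the domain of any other chart is covered by two open pieces: its overlap with \<open>U\<close>, where the
  extension is \<open>u\<close> after a transition map, and the complement of \<open>L\<close>, where it vanishes.\<close>

lemma extend_by_zero_smooth:
  fixes A :: "('a::{t2_space, second_countable_topology}, 'k::finite) atlas"
  assumes M: "smooth_manifold A" "(U, c) \<in> A" and u: "smooth_on (c ` U) u"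
    and K: "compact K" "K \<subseteq> c ` U" "\<And>x. x \<in> c ` U - K \<Longrightarrow> u x = 0"
  shows "(\<lambda>q. if q \<in> U then u (c q) else 0) \<in> smooth_functions A" (is "?F \<in> _")
  unfolding smooth_functions_def smooth_on_def
proof (clarify)
  fix W d k assume W: "(W, d) \<in> A"
  note U = chartD[OF M] and W' = chartD[OF M(1) W]
  let ?L = "inv_into U c ` K"
  have L: "closed ?L" "?L \<subseteq> U"
    using K continuous_on_subset[OF U(5)] inv_into_into[of _ c U]
    by (auto intro!: compact_imp_closed compact_continuous_image)
  have op: "open (d ` (W \<inter> U))" "open (d ` (W \<inter> - ?L))" using W' U L by blast+
  have "C_k_on k (d ` (W \<inter> U)) (\<lambda>x. u ((c \<circ> inv_into W d) x))"
  proof (rule C_k_on_compose[OF op(1), where f = u and g = "c \<circ> inv_into W d"])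
    have transition: "\<forall>(U, c)\<in>A. \<forall>(W, d)\<in>A. smooth_on (c ` (U \<inter> W)) (d \<circ> inv_into U c)"
      using M(1) unfolding smooth_manifold_def by blast
    from bspec[OF bspec[OF transition W, unfolded prod.case] M(2)]
    show "C_k_on k (d ` (W \<inter> U)) (c \<circ> inv_into W d)" by (simp add: smooth_on_def)
    show "C_k_on k (c ` U) u" using u by (simp add: smooth_on_def)
    show "(c \<circ> inv_into W d) ` d ` (W \<inter> U) \<subseteq> c ` U" using W'(3) by auto
  qed
  then have "C_k_on k (d ` (W \<inter> U)) (?F \<circ> inv_into W d)"
    by (rule C_k_on_cong[OF op(1)]) (use W'(3) in auto)
  moreover have "C_k_on k (d ` (W \<inter> - ?L)) (?F \<circ> inv_into W d)"
  proof (rule C_k_on_cong[OF op(2) C_k_on_const[of _ _ 0]])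
    fix x assume "x \<in> d ` (W \<inter> - ?L)"
    then obtain q where q: "q \<in> W" "q \<notin> ?L" "x = d q" by auto
    have "u (c q) = 0" if "q \<in> U"
      using that q(2) U(3) by (intro K(3)) (auto simp: image_iff)
    then show "0 = (?F \<circ> inv_into W d) x" using q W'(3) by simp
  qed
  moreover have "d ` W = d ` (W \<inter> U) \<union> d ` (W \<inter> - ?L)" using L(2) by blast
  ultimately show "C_k_on k (d ` W) (?F \<circ> inv_into W d)" using C_k_on_Un[OF op] by simp
qed

text \<open>The constant field \<open>v\<close> in the coordinates \<open>c\<close>, cut off by \<open>\<psi>\<close>. It must vanish on functions
  that are not smooth in order to take values in the tangent spaces.\<close>

definition chart_field ::
    "('a::{t2_space, second_countable_topology}, 'k::finite) atlas \<Rightarrow> 'a set \<Rightarrow> ('a \<Rightarrow> real ^ 'k) \<Rightarrow>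
     (real ^ 'k \<Rightarrow> real) \<Rightarrow> real ^ 'k \<Rightarrow> 'a vfield" where
  "chart_field A U c \<psi> v = (\<lambda>q f. if f \<in> smooth_functions A \<and> q \<in> U
     then \<psi> (c q) * frechet_derivative (f \<circ> inv_into U c) (at (c q)) v else 0)"

lemma smooth_function_has_derivative_chart:
  assumes "f \<in> smooth_functions A" "(U, c) \<in> A" "q \<in> U"
  shows "(f \<circ> inv_into U c has_derivative frechet_derivative (f \<circ> inv_into U c) (at (c q))) (at (c q))"
  using C_k_on_Suc_has_derivative[OF smooth_functionsD[OF assms(1,2), of "Suc 0"]] assms(3) by blast

lemma chart_field_tangent:
  fixes A :: "('a::{t2_space, second_countable_topology}, 'k::finite) atlas"
  assumes M: "smooth_manifold A" "(U, c) \<in> A"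
  shows "chart_field A U c \<psi> v q \<in> tangent_space A q"
proof (cases "q \<in> U")
  case True
  let ?D = "\<lambda>f. frechet_derivative (f \<circ> inv_into U c) (at (c q)) v"
  note der = smooth_function_has_derivative_chart[OF _ M(2) True]
  have q: "inv_into U c (c q) = q" using chartD(3)[OF M] True by simp
  have D_add: "?D (f + h) = ?D f + ?D h" if "f \<in> smooth_functions A" "h \<in> smooth_functions A" for f h
    using fun_cong[OF frechet_derivative_at[OF has_derivative_add[OF der[OF that(1)] der[OF that(2)]]], of v]
    by (simp add: o_def plus_fun_def)
  have D_scale: "?D (\<lambda>x. r * f x) = r * ?D f" if "f \<in> smooth_functions A" for f r
    using fun_cong[OF frechet_derivative_at[OF has_derivative_mult_right[OF der[OF that], of r]], of v]
    by (simp add: o_def)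
  have D_mult: "?D (f * h) = f q * ?D h + h q * ?D f"
    if "f \<in> smooth_functions A" "h \<in> smooth_functions A" for f h
    using fun_cong[OF frechet_derivative_at[OF has_derivative_mult[OF der[OF that(1)] der[OF that(2)]]], of v] q
    by (simp add: o_def times_fun_def mult.commute)
  show ?thesis unfolding tangent_space_def
  proof (intro CollectI conjI allI ballI impI)
    fix f h r assume f: "f \<in> smooth_functions A" and h: "h \<in> smooth_functions A"
    show "chart_field A U c \<psi> v q (f + h) = chart_field A U c \<psi> v q f + chart_field A U c \<psi> v q h"
      using True f h smooth_functions_add[OF M(1) f h]
      by (simp only: chart_field_def D_add[OF f h]) (simp add: distrib_left)
    show "chart_field A U c \<psi> v q (f * h) = f q * chart_field A U c \<psi> v q h + h q * chart_field A U c \<psi> v q f"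
      using True f h smooth_functions_mult[OF M(1) f h]
      by (simp only: chart_field_def D_mult[OF f h]) (simp add: distrib_left)
  next
    fix f r assume f: "f \<in> smooth_functions A"
    show "chart_field A U c \<psi> v q (\<lambda>x. r * f x) = r * chart_field A U c \<psi> v q f"
      using True f smooth_functions_scale[OF M(1) f, of r]
      by (simp only: chart_field_def D_scale[OF f]) simp
  qed (simp add: chart_field_def)
next
  case False
  then show ?thesis by (simp add: tangent_space_def chart_field_def)
qed

lemma chart_field_vector_field:
  fixes A :: "('a::{t2_space, second_countable_topology}, 'k::finite) atlas"
  assumes M: "smooth_manifold A" "(U, c) \<in> A" and \<psi>: "smooth_on (c ` U) \<psi>"
    and K: "compact K" "K \<subseteq> c ` U" "\<And>x. x \<notin> K \<Longrightarrow> \<psi> x = 0"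
  shows "chart_field A U c \<psi> v \<in> vector_fields A"
proof -
  have "vf_apply (chart_field A U c \<psi> v) f \<in> smooth_functions A" if f: "f \<in> smooth_functions A" for f
  proof -
    let ?u = "\<lambda>x. \<psi> x * frechet_derivative (f \<circ> inv_into U c) (at x) v"
    have "C_k_on k (c ` U) (\<lambda>x. frechet_derivative (f \<circ> inv_into U c) (at x) v)" for k
      using smooth_functionsD[OF f M(2), of "Suc k"] by simp
    then have "smooth_on (c ` U) ?u"
      using \<psi> unfolding smooth_on_def by (intro allI C_k_on_mult chartD(2)[OF M]) auto
    from extend_by_zero_smooth[OF M this K(1,2)] K(3) show ?thesis
      using f by (simp add: vf_apply_def chart_field_def)
  qed
  then show ?thesis by (simp add: vector_fields_def chart_field_tangent[OF M])
qed

lemma chart_field_linear: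
  fixes A :: "('a::{t2_space, second_countable_topology}, 'k::finite) atlas"
  assumes "(U, c) \<in> A"
  shows "chart_field A U c \<psi> (v + w) q = chart_field A U c \<psi> v q + chart_field A U c \<psi> w q"
    and "chart_field A U c \<psi> (r *\<^sub>R v) q = tscale r (chart_field A U c \<psi> v q)"
proof -
  have lin: "linear (frechet_derivative (f \<circ> inv_into U c) (at (c q)))"
    if "f \<in> smooth_functions A" "q \<in> U" for f
    using smooth_function_has_derivative_chart[OF that(1) assms that(2)] has_derivative_linear by blast
  show "chart_field A U c \<psi> (v + w) q = chart_field A U c \<psi> v q + chart_field A U c \<psi> w q"
    using linear_add[OF lin] by (auto simp: chart_field_def fun_eq_iff algebra_simps)
  show "chart_field A U c \<psi> (r *\<^sub>R v) q = tscale r (chart_field A U c \<psi> v q)"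
    using linear_scale[OF lin] by (auto simp: chart_field_def fun_eq_iff tscale_def)
qed

text \<open>Test the field on the linear coordinate in direction \<open>v\<close>, centred at \<open>p\<close>. This coordinate only
  exists on \<open>U\<close>, so it is cut off as well; being centred, it makes the term with the derivative of
  the cut-off function vanish at \<open>p\<close>, and the result is \<open>\<psi>(c p)\<^sup>2 |v|\<^sup>2\<close>.\<close>

lemma chart_field_nonzero:
  fixes A :: "('a::{t2_space, second_countable_topology}, 'k::finite) atlas"
  assumes M: "smooth_manifold A" "(U, c) \<in> A" and p: "p \<in> U" "\<psi> (c p) > 0"
    and \<psi>: "smooth_on (c ` U) \<psi>"
    and K: "compact K" "K \<subseteq> c ` U" "\<And>x. x \<notin> K \<Longrightarrow> \<psi> x = 0"
    and "v \<noteq> 0"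
  shows "chart_field A U c \<psi> v p \<noteq> 0"
proof -
  note U = chartD[OF M]
  let ?u = "\<lambda>x. \<psi> x * ((x + - c p) \<bullet> v)"
  let ?F = "\<lambda>q. if q \<in> U then ?u (c q) else 0"
  have "smooth_on (c ` U) ?u" using \<psi> unfolding smooth_on_def
    by (intro allI C_k_on_mult C_k_on_inner C_k_on_add C_k_on_const C_k_on_ident U(2)) auto
  then have F: "?F \<in> smooth_functions A"
    using extend_by_zero_smooth[OF M _ K(1,2), of ?u] K(3) by simp
  have "C_k_on (Suc 0) (c ` U) \<psi>" using \<psi> unfolding smooth_on_def by blast
  from C_k_on_Suc_has_derivative[OF this, of "c p"] p
  have d\<psi>: "(\<psi> has_derivative frechet_derivative \<psi> (at (c p))) (at (c p))" by simp
  have "((\<lambda>x. (x + - c p) \<bullet> v) has_derivative (\<lambda>w. w \<bullet> v)) (at (c p))"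
    by (auto intro!: derivative_eq_intros)
  from has_derivative_mult[OF d\<psi> this]
  have "(?u has_derivative (\<lambda>w. \<psi> (c p) * (w \<bullet> v))) (at (c p))" by simp
  then have der: "(?F \<circ> inv_into U c has_derivative (\<lambda>w. \<psi> (c p) * (w \<bullet> v))) (at (c p))"
    by (rule has_derivative_transform_within_open[OF _ U(2)]) (use p U(3) in auto)
  have "frechet_derivative (?F \<circ> inv_into U c) (at (c p)) v = \<psi> (c p) * (v \<bullet> v)"
    by (rule fun_cong[OF frechet_derivative_at[OF der], of v, symmetric])
  then have "chart_field A U c \<psi> v p ?F = \<psi> (c p) * (\<psi> (c p) * (v \<bullet> v))"
    using F p by (simp add: chart_field_def)
  also have "\<dots> \<noteq> 0" using p \<open>v \<noteq> 0\<close> by simp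
  finally show ?thesis by auto
qed

section \<open>Existence of orthonormal frames\<close>

text \<open>Gram--Schmidt. Rather than spans, the induction tracks supports: the vectors built for the index
  set \<open>J\<close> have no components outside \<open>J\<close>, so subtracting projections from a new unit vector leaves
  its component \<open>1\<close> untouched and the difference is nonzero.\<close>

lemma orthonormal_basis_of_bilinear_form:
  fixes B :: "real ^ 'k::finite \<Rightarrow> real ^ 'k \<Rightarrow> real"
  assumes add: "\<And>u v w. B (u + v) w = B u w + B v w" and scale: "\<And>r v w. B (r *\<^sub>R v) w = r * B v w"
    and sym: "\<And>v w. B v w = B w v" and pos: "\<And>v. v \<noteq> 0 \<Longrightarrow> B v v > 0"
  obtains e :: "'k \<Rightarrow> real ^ 'k" where "\<And>i j. B (e i) (e j) = (if i = j then 1 else 0)"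
proof -
  have zero: "B 0 w = 0" for w using scale[of 0 0 w] by simp
  have B_sum: "B (\<Sum>i\<in>I. r i *\<^sub>R v i) w = (\<Sum>i\<in>I. r i * B (v i) w)" for I :: "'k set" and r v w
    by (induction I rule: infinite_finite_induct) (simp_all add: zero add scale)
  have "\<exists>e. (\<forall>i\<in>J. \<forall>j\<in>J. B (e i) (e j) = (if i = j then 1 else 0)) \<and>
      (\<forall>j\<in>J. \<forall>i. i \<notin> J \<longrightarrow> e j $ i = 0)" if "finite J" for J :: "'k set"
    using that
  proof (induction J)
    case (insert k J)
    then obtain e where orth: "\<And>i j. i \<in> J \<Longrightarrow> j \<in> J \<Longrightarrow> B (e i) (e j) = (if i = j then 1 else 0)"
      and supp: "\<And>i j. j \<in> J \<Longrightarrow> i \<notin> J \<Longrightarrow> e j $ i = 0" by blast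
    define w where "w = axis k 1 + (\<Sum>i\<in>J. (- B (axis k 1) (e i)) *\<^sub>R e i)"
    have w_comp: "w $ i = axis k 1 $ i" if "i \<notin> J" for i
      using supp[OF _ that] by (simp add: w_def)
    have w: "w \<noteq> 0" using w_comp[OF insert.hyps(2)] by (auto simp: axis_def)
    have w_orth: "B w (e j) = 0" if "j \<in> J" for j
    proof -
      have "(\<Sum>i\<in>J. - B (axis k 1) (e i) * B (e i) (e j))
          = (\<Sum>i\<in>J. if i = j then - B (axis k 1) (e j) else 0)"
        by (rule sum.cong) (auto simp: orth that)
      then show ?thesis
        unfolding w_def add B_sum using that insert.hyps by simp
    qed
    let ?n = "(1 / sqrt (B w w)) *\<^sub>R w"
    have nn: "B ?n ?n = 1"
      using pos[OF w] by (simp add: scale sym[of w "_ *\<^sub>R w"])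
    have no: "B ?n (e j) = 0" "B (e j) ?n = 0" if "j \<in> J" for j
      using w_orth[OF that] sym[of "e j" ?n] by (simp_all add: scale)
    have nc: "?n $ i = 0" if "i \<notin> insert k J" for i
      using w_comp[of i] that by (simp add: axis_def)
    show ?case
      by (rule exI[of _ "e(k := ?n)"]) (use insert.hyps orth supp nn no nc in auto)
  qed auto
  from this[of UNIV] that show thesis by auto
qed

lemma orthonormal_frame_at_exists:
  fixes A :: "('a::{t2_space, second_countable_topology}, 'k::finite) atlas"
  assumes M: "smooth_manifold A" and h: "riemannian_metric A h"
  shows "\<exists>E. orthonormal_frame_at A h p E"
proof -
  have "p \<in> (\<Union>(U, c)\<in>A. U)" using M by (simp add: smooth_manifold_def)
  then obtain U c where Uc: "(U, c) \<in> A" "p \<in> U" by auto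
  obtain \<psi> :: "real ^ 'k \<Rightarrow> real" and K where \<psi>: "\<And>k T. open T \<Longrightarrow> C_k_on k T \<psi>" "\<psi> (c p) > 0"
    and K: "compact K" "K \<subseteq> c ` U" "\<And>x. x \<notin> K \<Longrightarrow> \<psi> x = 0"
    using bump_function_exists[OF chartD(2)[OF M Uc(1)] imageI[OF Uc(2)]] by blast
  have \<psi>_smooth: "smooth_on (c ` U) \<psi>"
    using \<psi>(1) chartD(2)[OF M Uc(1)] by (simp add: smooth_on_def)
  define X where "X = chart_field A U c \<psi>"
  have T: "X v p \<in> tangent_space A p" for v unfolding X_def by (rule chart_field_tangent[OF M Uc(1)])
  have lin: "X (v + w) p = X v p + X w p" "X (r *\<^sub>R v) p = tscale r (X v p)" for v w r
    unfolding X_def by (rule chart_field_linear[OF Uc(1)])+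
  have nz: "X v p \<noteq> 0" if "v \<noteq> 0" for v
    unfolding X_def by (rule chart_field_nonzero[OF M Uc \<psi>(2) \<psi>_smooth K that])
  let ?B = "\<lambda>v w. h p (X v p) (X w p)"
  have "?B (u + v) w = ?B u w + ?B v w" "?B (r *\<^sub>R v) w = r * ?B v w" "?B v w = ?B w v"
    "v \<noteq> 0 \<Longrightarrow> ?B v v > 0" for u v w r
    using h T nz by (simp_all add: riemannian_metric_def lin)
  then obtain e :: "'k \<Rightarrow> real ^ 'k"
    where e: "\<And>i j. h p (X (e i) p) (X (e j) p) = (if i = j then 1 else 0)"
    using orthonormal_basis_of_bilinear_form[of ?B] by blast
  have "X v \<in> vector_fields A" for v
    unfolding X_def by (rule chart_field_vector_field[OF M Uc(1) \<psi>_smooth K])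
  then have "orthonormal_frame_at A h p (\<lambda>i. X (e i))"
    by (simp add: orthonormal_frame_at_def e)
  then show ?thesis by (rule exI[of _ "\<lambda>i. X (e i)"])
qed

section \<open>Gradient almost Ricci solitons\<close>

lemma tangent_space_tscale: "v \<in> tangent_space A p \<Longrightarrow> tscale r v \<in> tangent_space A p"
  by (simp add: tangent_space_def tscale_def algebra_simps)

lemma tangent_space_diff:
  "u \<in> tangent_space A p \<Longrightarrow> v \<in> tangent_space A p \<Longrightarrow> u - v \<in> tangent_space A p"
  by (simp add: tangent_space_def algebra_simps)

lemma riemannian_metric_diff:
  assumes "riemannian_metric A h"
    and "u \<in> tangent_space A p" "v \<in> tangent_space A p" "w \<in> tangent_space A p"
  shows "h p (u - v) w = h p u w - h p v w"
proof -
  have eq: "u - v = u + tscale (- 1) v" by (auto simp: tscale_def)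
  have "h p (u + tscale (- 1) v) w = h p u w + h p (tscale (- 1) v) w"
    using assms tangent_space_tscale[OF assms(3)] unfolding riemannian_metric_def by blast
  moreover have "h p (tscale (- 1) v) w = - 1 * h p v w"
    using assms unfolding riemannian_metric_def by blast
  ultimately show ?thesis unfolding eq by simp
qed

text \<open>Differentiate \<open>Y f = h(V, Y)\<close> along \<open>X\<close>; metric compatibility of the connection produces an extra
  term \<open>h(V, D X Y) = (D X Y) f\<close>, which is exactly what the Hessian subtracts.\<close>

lemma hessian_eq_covariant_derivative:
  assumes D: "levi_civita A h D" and V: "is_gradient A h f V"
    and X: "X \<in> vector_fields A" and Y: "Y \<in> vector_fields A"
  shows "hessian D f X Y p = h p (D X V p) (Y p)"
proof -
  have T: "Z q \<in> tangent_space A q" if "Z \<in> vector_fields A" for Z q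
    using that by (simp add: vector_fields_def)
  have VV: "V \<in> vector_fields A" and Vf: "\<And>w q. w \<in> tangent_space A q \<Longrightarrow> w f = h q (V q) w"
    using V by (simp_all add: is_gradient_def)
  have DXY: "D X Y \<in> vector_fields A"
    using D X Y by (simp add: levi_civita_def affine_connection_def)
  have "vf_apply Y f = (\<lambda>q. h q (V q) (Y q))"
    using Vf[OF T[OF Y]] by (auto simp: vf_apply_def)
  moreover have "X p (\<lambda>q. h q (V q) (Y q)) = h p (D X V p) (Y p) + h p (V p) (D X Y p)"
    using D X VV Y unfolding levi_civita_def by blast
  ultimately show ?thesis by (simp add: hessian_def Vf[OF T[OF DXY]])
qed

lemma hessian_symmetric:
  assumes "levi_civita A h D" and "X \<in> vector_fields A" "Y \<in> vector_fields A"
  shows "hessian D f X Y p = hessian D f Y X p"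
proof -
  have "D X Y - D Y X = lie_bracket X Y" using assms by (simp add: levi_civita_def)
  from fun_cong[OF fun_cong[OF this, of p], of f] show ?thesis
    by (simp add: hessian_def lie_bracket_def)
qed

text \<open>Replacing brackets by covariant derivatives, \<open>L\<^sub>V h (X, Y) = h(D X V, Y) + h(X, D Y V)\<close>: the
  terms with \<open>D V\<close> cancel by metric compatibility. Both summands are the Hessian, by symmetry.\<close>

lemma lie_derivative_gradient:
  assumes h: "riemannian_metric A h" and D: "levi_civita A h D" and V: "is_gradient A h f V"
    and X: "X \<in> vector_fields A" and Y: "Y \<in> vector_fields A"
  shows "lie_derivative V h X Y p = 2 * hessian D f X Y p"
proof -
  have T: "Z q \<in> tangent_space A q" if "Z \<in> vector_fields A" for Z q
    using that by (simp add: vector_fields_def)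
  have VV: "V \<in> vector_fields A" using V by (simp add: is_gradient_def)
  have DV: "D Z W \<in> vector_fields A" if "Z \<in> vector_fields A" "W \<in> vector_fields A" for Z W
    using D that by (simp add: levi_civita_def affine_connection_def)
  have br: "lie_bracket V Z p = D V Z p - D Z V p" if "Z \<in> vector_fields A" for Z
  proof -
    have "D V Z - D Z V = lie_bracket V Z" using D VV that by (simp add: levi_civita_def)
    then show ?thesis by (metis fun_diff_def)
  qed
  have sym: "h p u w = h p w u" if "u \<in> tangent_space A p" "w \<in> tangent_space A p" for u w
    using h that by (simp add: riemannian_metric_def)
  have brT: "lie_bracket V Y p \<in> tangent_space A p"
    unfolding br[OF Y] by (intro tangent_space_diff T DV VV Y)
  have metr: "V p (\<lambda>q. h q (X q) (Y q)) = h p (D V X p) (Y p) + h p (X p) (D V Y p)"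
    using D VV X Y by (simp add: levi_civita_def)
  have "h p (lie_bracket V X p) (Y p) = h p (D V X p) (Y p) - h p (D X V p) (Y p)"
    unfolding br[OF X] by (intro riemannian_metric_diff[OF h] T DV VV X Y)
  moreover have "h p (X p) (lie_bracket V Y p) = h p (D V Y p) (X p) - h p (D Y V p) (X p)"
    using sym[OF T[OF X] brT] unfolding br[OF Y]
    by (simp only:) (intro riemannian_metric_diff[OF h] T DV VV X Y)
  moreover have "h p (X p) (D V Y p) = h p (D V Y p) (X p)"
    by (intro sym T DV VV X Y)
  ultimately show ?thesis
    using metr hessian_symmetric[OF D X Y, of f p]
      hessian_eq_covariant_derivative[OF D V X Y, of p]
      hessian_eq_covariant_derivative[OF D V Y X, of p]
    by (simp add: lie_derivative_def)
qed

text \<open>The difference of the two sides is \<open>(m t - tr H)\<^sup>2 / m\<close>, where \<open>m\<close> is the size of the matrices.\<close>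

lemma sum_squares_scalar_minus_matrix:
  fixes H R :: "'k::finite \<Rightarrow> 'k \<Rightarrow> real"
  assumes "\<And>i j. H i j + R i j = (if i = j then t else 0)"
  shows "(\<Sum>i\<in>UNIV. \<Sum>j\<in>UNIV. (R i j)\<^sup>2) \<ge>
    (\<Sum>i\<in>UNIV. \<Sum>j\<in>UNIV. (H i j)\<^sup>2) - 1 / real CARD('k) * (\<Sum>i\<in>UNIV. H i i)\<^sup>2"
proof -
  define m where "m = real CARD('k)"
  define s where "s = (\<Sum>i\<in>UNIV. H i i)"
  have m: "m > 0" by (simp add: m_def)
  have "(R i j)\<^sup>2 = (H i j)\<^sup>2 + (if i = j then t\<^sup>2 - 2 * t * H i i else 0)" for i j
  proof -
    have R: "R i j = (if i = j then t else 0) - H i j" using assms[of i j] by simp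
    show ?thesis unfolding R by (simp add: power2_eq_square algebra_simps)
  qed
  then have "(\<Sum>i\<in>UNIV. \<Sum>j\<in>UNIV. (R i j)\<^sup>2)
      = (\<Sum>i\<in>UNIV. \<Sum>j\<in>UNIV. (H i j)\<^sup>2) + (m * t\<^sup>2 - 2 * t * s)"
    by (simp add: sum.distrib sum_subtractf sum_distrib_left m_def s_def)
  moreover have "m * t\<^sup>2 - 2 * t * s + 1 / m * s\<^sup>2 = (m * t - s)\<^sup>2 / m"
    using m by (simp add: field_simps power2_eq_square)
  moreover have "(m * t - s)\<^sup>2 / m \<ge> 0" using m by simp
  ultimately show ?thesis unfolding m_def[symmetric] s_def[symmetric] by linarith
qed

text \<open>The choice of frame in the norms and in the Laplacian is harmless: all of them refer to the same
  frame, and it is orthonormal because one exists.\<close>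

theorem gradient_almost_ricci_soliton_norm_ineq:
  fixes A :: "('a::{t2_space, second_countable_topology}, 'k::finite) atlas"
  assumes M: "smooth_manifold A" and h: "riemannian_metric A h" and D: "levi_civita A h D"
    and V: "is_gradient A h f V" and sol: "almost_ricci_soliton A h D V l"
  shows "(hs_norm A h (ricci A h D) p)\<^sup>2
    \<ge> (hs_norm A h (hessian D f) p)\<^sup>2 - 1 / real CARD('k) * (laplacian A h D f p)\<^sup>2"
proof -
  define E where "E = orthonormal_frame A h p"
  have E: "orthonormal_frame_at A h p E"
    unfolding E_def orthonormal_frame_def
    by (rule someI_ex[OF orthonormal_frame_at_exists[OF M h]])
  have EV: "E i \<in> vector_fields A" for i using E by (simp add: orthonormal_frame_at_def)
  have "hessian D f (E i) (E j) p + ricci A h D (E i) (E j) p = (if i = j then l p else 0)" for i j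
  proof -
    have "1 / 2 * lie_derivative V h (E i) (E j) p + ricci A h D (E i) (E j) p
        = l p * h p (E i p) (E j p)"
      using sol EV by (simp add: almost_ricci_soliton_def)
    then show ?thesis
      using E by (simp add: lie_derivative_gradient[OF h D V EV EV] orthonormal_frame_at_def)
  qed
  from sum_squares_scalar_minus_matrix[OF this] show ?thesis
    by (simp add: hs_norm_def laplacian_def metric_trace_def E_def[symmetric] sum_nonneg)
qed

section \<open>The deformed metric\<close>

text \<open>For \<open>a < 1\<close> the added term is negative; positivity is seen by rewriting the quadratic form as
  \<open>a g(\<phi> v, \<phi> v) + a\<^sup>2 \<eta>(v)\<^sup>2\<close>, a sum of nonnegative terms that reduces to \<open>a g(v, v)\<close>
  where \<open>\<eta>(v) = 0\<close>.\<close>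

lemma deformed_metric_riemannian:
  assumes acm: "almost_contact_metric A \<phi> \<xi> \<eta> g" and a: "a > 0"
  shows "riemannian_metric A (\<lambda>p v w. a * g p v w + a * (a - 1) * (\<eta> p v * \<eta> p w))"
proof -
  have M: "smooth_manifold A" and g: "riemannian_metric A g" and \<eta>: "one_form A \<eta>"
    and \<phi>: "\<And>p v. v \<in> tangent_space A p \<Longrightarrow> \<phi> p v \<in> tangent_space A p"
    and compat: "\<And>p v w. v \<in> tangent_space A p \<Longrightarrow> w \<in> tangent_space A p \<Longrightarrow>
      g p (\<phi> p v) (\<phi> p w) = g p v w - \<eta> p v * \<eta> p w"
    using acm by (auto simp: almost_contact_metric_def tensor_field_1_1_def)
  have g_pos: "g p v v > 0" if "v \<in> tangent_space A p" "v \<noteq> 0" for p v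
    using g that by (simp add: riemannian_metric_def)
  have g_nonneg: "g p v v \<ge> 0" if v: "v \<in> tangent_space A p" for p v
  proof (cases "v = 0")
    case True
    have "g p (tscale 0 v) v = 0 * g p v v" using g v unfolding riemannian_metric_def by blast
    moreover have "tscale 0 v = v" using True by (auto simp: tscale_def)
    ultimately show ?thesis by simp
  qed (use g_pos[OF v] in force)
  have pos: "a * g p v v + a * (a - 1) * (\<eta> p v * \<eta> p v) > 0"
    if v: "v \<in> tangent_space A p" "v \<noteq> 0" for p v
  proof -
    have "a * g p v v + a * (a - 1) * (\<eta> p v * \<eta> p v)
        = a * g p (\<phi> p v) (\<phi> p v) + (a * \<eta> p v)\<^sup>2"
      by (simp add: compat[OF v(1) v(1)] power2_eq_square algebra_simps)
    moreover have "a * g p (\<phi> p v) (\<phi> p v) \<ge> 0" using a g_nonneg[OF \<phi>[OF v(1)]] by simp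
    moreover have "a * g p v v > 0" using a g_pos[OF v] by simp
    ultimately show ?thesis using a by (cases "\<eta> p v = 0") (auto intro: add_nonneg_pos)
  qed
  have smooth: "(\<lambda>p. a * g p (X p) (Y p) + a * (a - 1) * (\<eta> p (X p) * \<eta> p (Y p))) \<in> smooth_functions A"
    if "X \<in> vector_fields A" "Y \<in> vector_fields A" for X Y
  proof -
    have "(\<lambda>p. g p (X p) (Y p)) \<in> smooth_functions A"
      "(\<lambda>p. \<eta> p (X p)) \<in> smooth_functions A" "(\<lambda>p. \<eta> p (Y p)) \<in> smooth_functions A"
      using that g \<eta> by (simp_all add: riemannian_metric_def one_form_def)
    then show ?thesis
      using smooth_functions_add[OF M smooth_functions_scale[OF M, of "\<lambda>p. g p (X p) (Y p)" a]
          smooth_functions_scale[OF M smooth_functions_mult[OF M], of "\<lambda>p. \<eta> p (X p)" "\<lambda>p. \<eta> p (Y p)" "a * (a - 1)"]]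
      by (simp add: plus_fun_def times_fun_def)
  qed
  show ?thesis
    using g \<eta> pos smooth
    by (auto simp: riemannian_metric_def one_form_def algebra_simps)
qed

theorem theorem4p9:
  fixes A :: "('a::{t2_space, second_countable_topology}, 'k::finite) atlas"
    and \<phi> \<phi>' :: "'a \<Rightarrow> 'a tvec \<Rightarrow> 'a tvec"
    and \<xi> \<xi>' V :: "'a vfield"
    and \<eta> \<eta>' :: "'a \<Rightarrow> 'a tvec \<Rightarrow> real"
    and g g' :: "'a metric"
    and D' :: "'a connection"
    and f l :: "'a \<Rightarrow> real"
    and a :: real and n :: nat
  assumes "n \<ge> 1" and "CARD('k) = 2 * n + 1"
    and "kenmotsu A \<phi> \<xi> \<eta> g"
    and "a > 0"
    and "(\<phi>', \<xi>', \<eta>', g') = D_homothetic_deformation a (\<phi>, \<xi>, \<eta>, g)"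
    and "levi_civita A g' D'"
    and "f \<in> smooth_functions A"
    and "is_gradient A g' f V"
    and "almost_ricci_soliton A g' D' V l"
  shows "\<forall>p. (hs_norm A g' (ricci A g' D') p)\<^sup>2
           \<ge> (hs_norm A g' (hessian D' f) p)\<^sup>2 - 1 / real (2 * n + 1) * (laplacian A g' D' f p)\<^sup>2"
proof -
  have acm: "almost_contact_metric A \<phi> \<xi> \<eta> g" using assms(3) by (simp add: kenmotsu_def)
  have g': "g' = (\<lambda>p v w. a * g p v w + a * (a - 1) * (\<eta> p v * \<eta> p w))"
    using assms(5) by (simp add: D_homothetic_deformation_def)
  have "riemannian_metric A g'" unfolding g' by (rule deformed_metric_riemannian[OF acm assms(4)])
  moreover have "smooth_manifold A" using acm by (simp add: almost_contact_metric_def)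
  ultimately show ?thesis
    using gradient_almost_ricci_soliton_norm_ineq[OF _ _ assms(6,8,9)] assms(2) by metis
qed

end
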